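(* Let $K \subseteq \mathbb{R}^n$ be a convex body and let $p$ be a point in the interior of $K$. Then the depth function $\delta^p \colon S^{n-1} \to \mathbb{R}$ is a $C^1$ function. In addition, $v \in S^{n-1}$ is a critical point of $\delta^p$ (that is, $D\delta^p(v) = 0$) if and only if the hyperplane $h_v^p$ is barycentric, i.e. $p$ is the barycenter of $K \cap h_v^p$.
   Context: A convex body in $\mathbb{R}^n$ is a compact convex set with nonempty interior. Let $\lambda$ be the Lebesgue measure on $\mathbb{R}^n$. For $v \in S^{n-1}$ (the unit sphere in $\mathbb{R}^n$), let $h_v^p = \{x \in \mathbb{R}^n : \langle v, x-p\rangle = 0\}$ and $H_v^p = \{x \in \mathbb{R}^n : \langle v, x-p\rangle \geq 0\}$, and define the depth function by $\delta^p(v) = \lambda(H_v^p \cap K)/\lambda(K)$. The sphere $S^{n-1}$ is viewed as a smooth manifold with its standard differential structure, and $Df(v)$ denotes the total derivative of a function $f$ at $v$. For a hyperplane $h$ and a bounded measurable set $Y \subseteq h$ of positive $(n-1)$-dimensional Lebesgue measure $\lambda_{n-1}(Y)$, the barycenter of $Y$ is the point $\frac{1}{\lambda_{n-1}(Y)}\int_Y x \, d\lambda_{n-1}(x)$. *)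

theory Defs
  imports "HOL-Analysis.Analysis"
begin

definition convex_body :: "'a::euclidean_space set \<Rightarrow> bool" where
  "convex_body K \<longleftrightarrow> compact K \<and> convex K \<and> interior K \<noteq> {}"

definition hyperplane_through :: "'a::euclidean_space \<Rightarrow> 'a \<Rightarrow> 'a set" where
  "hyperplane_through v p = {x. v \<bullet> (x - p) = 0}"

definition halfspace_through :: "'a::euclidean_space \<Rightarrow> 'a \<Rightarrow> 'a set" where
  "halfspace_through v p = {x. v \<bullet> (x - p) \<ge> 0}"

definition depth :: "'a::euclidean_space set \<Rightarrow> 'a \<Rightarrow> 'a \<Rightarrow> real" where
  "depth K p v = measure lebesgue (halfspace_through v p \<inter> K) / measure lebesgue K"


subsection \<open>Lebesgue measure on an affine subspace\<close>

definition orthonormal_frame :: "'a::euclidean_space set \<Rightarrow> 'a \<times> 'a set \<Rightarrow> bool" where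
  "orthonormal_frame A = (\<lambda>(a, B). pairwise orthogonal B \<and> (\<forall>b\<in>B. norm b = 1) \<and>
     A = (\<lambda>x. a + x) ` span B)"

lemma orthonormal_frame_exists:
  fixes A :: "'a::euclidean_space set"
  assumes "affine A" "A \<noteq> {}"
  shows "\<exists>F. orthonormal_frame A F"
proof -
  obtain a where a: "a \<in> A" using assms by blast
  obtain S where S: "subspace S" "A = (\<lambda>x. a + x) ` S"
    using affine_diffs_subspace[OF assms(1) a]
    by (force simp: image_image)
  obtain B where "pairwise orthogonal B" "\<And>b. b \<in> B \<Longrightarrow> norm b = 1" "span B = S"
    using orthonormal_basis_subspace[OF S(1)] by metis
  then have "orthonormal_frame A (a, B)"
    using S(2) by (simp add: orthonormal_frame_def)
  then show ?thesis ..
qed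

text \<open>
  For an affine subspace \<open>A\<close> of dimension \<open>k\<close>, the image of \<open>k\<close>-dimensional Lebesgue measure
  under an isometric parametrisation of \<open>A\<close>, as a Borel measure on the ambient space (compare the
  definition of \<^const>\<open>lborel\<close>). Since Lebesgue measure is invariant under isometries, the chosen
  frame does not matter. A single point has measure 1 when \<open>k = 0\<close>.
\<close>
definition affine_lborel :: "'a::euclidean_space set \<Rightarrow> 'a measure" where
  "affine_lborel A = (let (a, B) = (SOME F. orthonormal_frame A F) in
     distr (\<Pi>\<^sub>M b\<in>B. lborel) borel (\<lambda>f. a + (\<Sum>b\<in>B. f b *\<^sub>R b)))"

definition barycenter :: "'a::euclidean_space set \<Rightarrow> 'a set \<Rightarrow> 'a" where
  "barycenter h Y = (1 / measure (affine_lborel h) Y) *\<^sub>R (LINT x:Y|affine_lborel h. x)"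

definition barycentric :: "'a::euclidean_space set \<Rightarrow> 'a \<Rightarrow> 'a \<Rightarrow> bool" where
  "barycentric K p v \<longleftrightarrow>
     barycenter (hyperplane_through v p) (K \<inter> hyperplane_through v p) = p"


subsection \<open>Differentiability on the unit sphere\<close>

text \<open>
  The standard differential structure of the unit sphere is given by the graph charts: for each
  unit vector \<open>u\<close>, the open hemisphere \<open>{w \<in> sphere 0 1. u \<bullet> w > 0}\<close> is mapped by orthogonal
  projection onto the open unit ball of the \<open>(n-1)\<close>-dimensional Euclidean space
  \<open>tangent_space u\<close>. The function \<open>sphere_param u\<close> is the inverse of that chart.
\<close>

definition tangent_space :: "'a::euclidean_space \<Rightarrow> 'a set" where
  "tangent_space u = {x. u \<bullet> x = 0}"

definition chart_ball :: "'a::euclidean_space \<Rightarrow> 'a set" where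
  "chart_ball u = tangent_space u \<inter> ball 0 1"

definition sphere_param :: "'a::euclidean_space \<Rightarrow> 'a \<Rightarrow> 'a" where
  "sphere_param u x = x + sqrt (1 - (norm x)\<^sup>2) *\<^sub>R u"

lemma bij_betw_sphere_param:
  fixes u :: "'a::euclidean_space"
  assumes "norm u = 1"
  shows "bij_betw (sphere_param u) (chart_ball u) {w \<in> sphere 0 1. u \<bullet> w > 0}"
proof (rule bij_betw_byWitness[where f' = "\<lambda>w. w - (u \<bullet> w) *\<^sub>R u"])
  have uu: "u \<bullet> u = 1" using assms by (simp add: dot_square_norm)
  have lt: "(norm x)\<^sup>2 < 1" if "norm x < 1" for x :: 'a
    using that by (simp add: power_less_one_iff abs_square_less_1)
  show "\<forall>x\<in>chart_ball u. sphere_param u x - (u \<bullet> sphere_param u x) *\<^sub>R u = x"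
    using uu by (auto simp: chart_ball_def tangent_space_def sphere_param_def inner_add_right)
  have n: "(norm (w - (u \<bullet> w) *\<^sub>R u))\<^sup>2 = 1 - (u \<bullet> w)\<^sup>2" if "norm w = 1" for w
    using that uu unfolding power2_norm_eq_inner norm_eq_1
    by (simp add: inner_diff_left inner_diff_right inner_commute power2_eq_square)
  then show "\<forall>w\<in>{w \<in> sphere 0 1. u \<bullet> w > 0}. sphere_param u (w - (u \<bullet> w) *\<^sub>R u) = w"
    by (auto simp: sphere_param_def)
  show "sphere_param u ` chart_ball u \<subseteq> {w \<in> sphere 0 1. u \<bullet> w > 0}"
  proof clarsimp
    fix x assume "x \<in> chart_ball u"
    then have x: "u \<bullet> x = 0" "norm x < 1" by (auto simp: chart_ball_def tangent_space_def)
    have "(norm (sphere_param u x))\<^sup>2 = 1"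
      using x uu lt[of x]
      by (simp add: sphere_param_def power2_norm_eq_inner inner_add_left inner_add_right
          inner_commute[of x u])
    moreover have "u \<bullet> sphere_param u x > 0"
      using x uu lt[of x] by (simp add: sphere_param_def inner_add_right)
    ultimately show "norm (sphere_param u x) = 1 \<and> 0 < u \<bullet> sphere_param u x"
      by (simp add: power2_eq_1_iff) (smt (verit) norm_ge_zero)
  qed
  show "(\<lambda>w. w - (u \<bullet> w) *\<^sub>R u) ` {w \<in> sphere 0 1. u \<bullet> w > 0} \<subseteq> chart_ball u"
  proof clarsimp
    fix w assume w: "norm w = 1" "u \<bullet> w > 0"
    have "(norm (w - (u \<bullet> w) *\<^sub>R u))\<^sup>2 < 1\<^sup>2" using n[OF w(1)] w(2) by simp
    then have "norm (w - (u \<bullet> w) *\<^sub>R u) < 1" by (rule power_less_imp_less_base) simp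
    then show "w - (u \<bullet> w) *\<^sub>R u \<in> chart_ball u"
      using uu by (simp add: chart_ball_def tangent_space_def inner_diff_right)
  qed
qed

text \<open>
  Continuous differentiability of a function on a relatively open subset \<open>U\<close> of a linear
  subspace \<open>V\<close>. The derivative at a point is only determined on \<open>V\<close>; asking for a
  continuous choice of functionals on the whole space is no restriction, because functionals on
  \<open>V\<close> extend by composition with the orthogonal projection.
\<close>
definition C1_on :: "('a::euclidean_space \<Rightarrow> real) \<Rightarrow> 'a set \<Rightarrow> bool" where
  "C1_on g U \<longleftrightarrow> (\<exists>g' :: 'a \<Rightarrow> 'a \<Rightarrow>\<^sub>L real.
     (\<forall>x\<in>U. (g has_derivative blinfun_apply (g' x)) (at x within U)) \<and> continuous_on U g')"

definition C1_on_sphere :: "('a::euclidean_space \<Rightarrow> real) \<Rightarrow> bool" where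
  "C1_on_sphere f \<longleftrightarrow> (\<forall>u\<in>sphere 0 1. C1_on (f \<circ> sphere_param u) (chart_ball u))"

text \<open>
  The total derivative at \<open>v\<close>, computed in the chart centred at \<open>v\<close>. The derivative of
  \<open>sphere_param v\<close> at \<open>0\<close> is the inclusion of \<open>tangent_space v\<close>, so the restriction of \<open>L\<close> to
  \<open>tangent_space v\<close> is the differential of \<open>f\<close> at \<open>v\<close>; values of \<open>L\<close> elsewhere are irrelevant.
\<close>
definition has_sphere_derivative :: "('a::euclidean_space \<Rightarrow> real) \<Rightarrow> ('a \<Rightarrow> real) \<Rightarrow> 'a \<Rightarrow> bool" where
  "has_sphere_derivative f L v \<longleftrightarrow>
     ((f \<circ> sphere_param v) has_derivative L) (at 0 within chart_ball v)"

definition critical_point :: "('a::euclidean_space \<Rightarrow> real) \<Rightarrow> 'a \<Rightarrow> bool" where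
  "critical_point f v \<longleftrightarrow>
     (\<exists>L. has_sphere_derivative f L v \<and> (\<forall>w\<in>tangent_space v. L w = 0))"

end

theory Submission
  imports Defs
begin

text \<open>
  Fix a unit vector \<open>u\<close> and let \<open>h\<close> be the hyperplane through \<open>p\<close> orthogonal to \<open>u\<close>. Half-spaces
  do not change when their normal is rescaled, so near \<open>u\<close> it suffices to consider normals \<open>u + y\<close>
  with \<open>y\<close> orthogonal to \<open>u\<close>. By Fubini along the lines in direction \<open>u\<close>, the volume of the cap of
  \<open>K\<close> with normal \<open>u + y\<close> is the integral over \<open>z\<close> in \<open>h\<close> of the length of the part of the chord
  \<open>{t. z + t u \<in> K}\<close> with \<open>t \<ge> - (y \<bullet> (z - p))\<close>.

  As a function of the cut, this length is Lipschitz with constant 1, and it is locally affine, of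
  slope 1 or 0, unless the cut \<open>z - (y \<bullet> (z - p)) u\<close> is on the frontier of \<open>K\<close>. By convexity, and
  because \<open>p\<close> is an interior point, the latter happens only for a null set of \<open>z\<close>
  (\<open>AE_tilted_hyperplane_notin_frontier\<close>). Dominated convergence therefore differentiates under
  the integral (\<open>cap_volume_has_derivative\<close>): the gradient at \<open>y\<close> is the integral of \<open>z - p\<close>
  over those \<open>z\<close> whose cut lies in \<open>K\<close>, and it depends continuously on \<open>y\<close>
  (\<open>continuous_section_moment\<close>). Composition with the smooth change of chart from unit normals
  to normals \<open>u + y\<close> makes the depth function continuously differentiable.

  At \<open>y = 0\<close> the gradient is the first moment about \<open>p\<close> of the section of \<open>K\<close> by \<open>h\<close>. It is a
  tangent vector, so \<open>u\<close> is critical exactly if this moment vanishes, that is, if \<open>p\<close> is the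
  barycenter of the section.
\<close>

section \<open>Lebesgue measure in an orthonormal frame\<close>

text \<open>
  The usual double-counting argument for the uniqueness of Haar measure: integrate
  \<open>indicator A x * indicator B (x + y)\<close>, with \<open>B\<close> the unit ball, in both orders. Integrating over
  \<open>y\<close> first gives \<open>M A * lborel B\<close>; shifting \<open>x\<close> by \<open>- y\<close> first gives \<open>lborel A * M B\<close>.
\<close>
lemma lborel_unique_translation_invariant:
  fixes M :: "'a::euclidean_space measure"
  assumes sets [measurable_cong]: "sets M = sets borel"
    and fin: "sigma_finite_measure M"
    and trans: "\<And>c. distr M borel (\<lambda>x. c + x) = M"
    and ball: "emeasure M (ball 0 1) = emeasure lborel (ball (0::'a) 1)"
  shows "M = lborel"
proof (rule measure_eqI)
  show "sets M = sets lborel" using sets by simp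
next
  fix A assume "A \<in> sets M"
  then have A [measurable]: "A \<in> sets borel" using sets by simp
  let ?B = "ball (0::'a) 1"
  have B [measurable]: "?B \<in> sets borel" by simp
  interpret M: sigma_finite_measure M by fact
  interpret P: pair_sigma_finite M lborel ..
  have shift: "(\<integral>\<^sup>+y. indicator X (x + y) \<partial>lborel) = emeasure lborel X"
    if [measurable]: "X \<in> sets borel" for X :: "'a set" and x
    using nn_integral_distr[of "\<lambda>y. x + y" lborel borel "indicator X"] lborel_distr_plus[of x] by simp
  have reflect: "(\<integral>\<^sup>+y. indicator X (x - y) \<partial>lborel) = emeasure lborel X"
    if [measurable]: "X \<in> sets borel" for X :: "'a set" and x
    using nn_integral_distr[of "\<lambda>y. x - y" lborel borel "indicator X"]
      lborel_affine[of "-1::real" "x::'a"] by (simp add: density_1)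
  have "emeasure M A * emeasure lborel ?B = (\<integral>\<^sup>+x. indicator A x * emeasure lborel ?B \<partial>M)"
    by (simp add: nn_integral_multc sets)
  also have "\<dots> = (\<integral>\<^sup>+x. (\<integral>\<^sup>+y. indicator A x * indicator ?B (x + y) \<partial>lborel) \<partial>M)"
  proof (rule nn_integral_cong)
    fix x :: 'a
    show "indicator A x * emeasure lborel ?B = (\<integral>\<^sup>+y. indicator A x * indicator ?B (x + y) \<partial>lborel)"
    proof -
      have "(\<lambda>y. indicator ?B (x + y) :: ennreal) \<in> borel_measurable lborel" by measurable
      then show ?thesis using shift[of ?B x] by (simp only: nn_integral_cmult) simp
    qed
  qed
  also have "\<dots> = (\<integral>\<^sup>+y. (\<integral>\<^sup>+x. indicator A x * indicator ?B (x + y) \<partial>M) \<partial>lborel)"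
    by (rule P.Fubini'[symmetric]) measurable
  also have "\<dots> = (\<integral>\<^sup>+y. (\<integral>\<^sup>+x. indicator A (x - y) * indicator ?B x \<partial>M) \<partial>lborel)"
  proof (rule nn_integral_cong)
    fix y :: 'a
    have "(\<integral>\<^sup>+x. indicator A (x - y) * indicator ?B x \<partial>M)
        = (\<integral>\<^sup>+x. indicator A (x - y) * indicator ?B x \<partial>distr M borel (\<lambda>x. y + x))"
      by (simp add: trans)
    also have "\<dots> = (\<integral>\<^sup>+x. indicator A x * indicator ?B (x + y) \<partial>M)"
      by (subst nn_integral_distr) (auto simp: add.commute)
    finally show "(\<integral>\<^sup>+x. indicator A x * indicator ?B (x + y) \<partial>M)
        = (\<integral>\<^sup>+x. indicator A (x - y) * indicator ?B x \<partial>M)" ..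
  qed
  also have "\<dots> = (\<integral>\<^sup>+x. (\<integral>\<^sup>+y. indicator A (x - y) * indicator ?B x \<partial>lborel) \<partial>M)"
    by (rule P.Fubini') measurable
  also have "\<dots> = (\<integral>\<^sup>+x. emeasure lborel A * indicator ?B x \<partial>M)"
  proof (rule nn_integral_cong)
    fix x :: 'a
    show "(\<integral>\<^sup>+y. indicator A (x - y) * indicator ?B x \<partial>lborel) = emeasure lborel A * indicator ?B x"
      by (simp add: nn_integral_multc reflect)
  qed
  also have "\<dots> = emeasure lborel A * emeasure M ?B"
    by (simp add: nn_integral_cmult sets)
  finally have "emeasure lborel ?B * emeasure M A = emeasure lborel ?B * emeasure lborel A"
    by (simp add: ball mult.commute)
  moreover have "emeasure lborel ?B \<noteq> \<infinity>"
    using emeasure_lborel_ball_finite[of "0::'a" 1] by auto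
  moreover have "emeasure lborel ?B \<noteq> 0"
    using open_not_negligible[of ?B] by (auto simp: negligible_iff_emeasure0 emeasure_completion)
  ultimately show "emeasure M A = emeasure lborel A"
    by (auto simp: ennreal_mult_cancel_left)
qed

text \<open>
  The image of Lebesgue measure under a linear isometry is again translation invariant, because
  the isometry is onto, and it gives centred balls their Lebesgue measure.
\<close>
lemma lborel_distr_isometry:
  fixes T :: "'a::euclidean_space \<Rightarrow> 'a"
  assumes T: "orthogonal_transformation T"
  shows "distr lborel borel T = lborel"
proof -
  have lin: "linear T" using T by (rule orthogonal_transformation_linear)
  have [measurable]: "T \<in> borel_measurable borel"
    by (intro borel_measurable_continuous_onI linear_continuous_on linear_conv_bounded_linear[THEN iffD1] lin)
  let ?M = "distr lborel borel T"
  have vimage: "T -` ball 0 r = ball 0 r" for r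
    using T by (auto simp: orthogonal_transformation_norm)
  have emeasure_ball: "emeasure ?M (ball 0 r) = emeasure lborel (ball (0::'a) r)" for r
    by (subst emeasure_distr) (auto simp: vimage)
  have "sigma_finite_measure ?M"
  proof
    show "\<exists>A. countable A \<and> A \<subseteq> sets ?M \<and> \<Union>A = space ?M \<and> (\<forall>a\<in>A. emeasure ?M a \<noteq> \<infinity>)"
    proof (intro exI conjI ballI)
      show "countable (range (\<lambda>n::nat. ball (0::'a) (real n)))" by simp
      show "\<Union>(range (\<lambda>n::nat. ball (0::'a) (real n))) = space ?M"
        using reals_Archimedean2 by auto
      show "emeasure ?M a \<noteq> \<infinity>" if "a \<in> range (\<lambda>n::nat. ball (0::'a) (real n))" for a
      proof -
        obtain n where "a = ball 0 (real n)" using \<open>a \<in> _\<close> by auto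
        then show ?thesis using emeasure_ball[of "real n"] emeasure_lborel_ball_finite[of "0::'a" "real n"] by simp
      qed
    qed auto
  qed
  moreover have "distr ?M borel (\<lambda>x. c + x) = ?M" for c
  proof -
    obtain d where d: "T d = c" using orthogonal_transformation_surj[OF T] by (metis surj_def)
    have "distr ?M borel (\<lambda>x. c + x) = distr (distr lborel borel (\<lambda>x. d + x)) borel T"
      using d by (simp add: distr_distr comp_def linear_add[OF lin])
    also have "\<dots> = ?M" by (simp add: lborel_distr_plus)
    finally show ?thesis .
  qed
  ultimately show ?thesis
    by (intro lborel_unique_translation_invariant emeasure_ball) auto
qed

lemma orthonormal_basis_finite:
  fixes B :: "'a::euclidean_space set"
  assumes "pairwise orthogonal B" "\<forall>b\<in>B. norm b = 1"
  shows "independent B" "finite B"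
proof -
  have "0 \<notin> B" using assms(2) by force
  then show "independent B" using assms(1) pairwise_orthogonal_independent by blast
  then show "finite B" using independent_imp_finite by blast
qed

text \<open>
  Lebesgue measure is defined through the standard basis. A bijection \<open>\<sigma>\<close> from it to \<open>C\<close> extends to
  a linear isometry \<open>T\<close>, which preserves Lebesgue measure, and product measure does not see the
  renaming of coordinates.
\<close>
lemma lborel_orthonormal_basis:
  fixes C :: "'a::euclidean_space set"
  assumes C: "pairwise orthogonal C" "\<forall>b\<in>C. norm b = 1" "span C = UNIV"
  shows "distr (\<Pi>\<^sub>M b\<in>C. lborel) borel (\<lambda>f. \<Sum>b\<in>C. f b *\<^sub>R b) = (lborel :: 'a measure)"
proof -
  have fin: "finite C" and ind: "independent C"
    using orthonormal_basis_finite[OF C(1,2)] by auto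
  have "card C = card (Basis :: 'a set)"
    using basis_card_eq_dim[of C UNIV] ind C(3) by simp
  then obtain \<sigma> where \<sigma>: "bij_betw \<sigma> (Basis :: 'a set) C"
    using finite_same_card_bij[OF finite_Basis fin] by auto
  define T where "T x = (\<Sum>b\<in>Basis. (x \<bullet> b) *\<^sub>R \<sigma> b)" for x :: 'a
  have inner_\<sigma>: "\<sigma> b \<bullet> \<sigma> b' = (if b = b' then 1 else 0)" if "b \<in> Basis" "b' \<in> Basis" for b b'
  proof (cases "b = b'")
    case True
    then show ?thesis using C(2) \<sigma> that by (metis bij_betwE dot_square_norm power_one)
  next
    case False
    then have "\<sigma> b \<noteq> \<sigma> b'" using \<sigma> that by (metis bij_betw_inv_into_left)
    then show ?thesis using C(1) \<sigma> that False by (metis bij_betwE orthogonal_def pairwise_def)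
  qed
  have "T x \<bullet> T y = x \<bullet> y" for x y
  proof -
    have "T x \<bullet> T y = (\<Sum>b\<in>Basis. \<Sum>b'\<in>Basis. (x \<bullet> b) * ((y \<bullet> b') * (\<sigma> b \<bullet> \<sigma> b')))"
      unfolding T_def inner_sum_left inner_sum_right inner_scaleR_left inner_scaleR_right
        sum_distrib_left by (subst sum.swap) (intro sum.cong refl, simp add: ac_simps)
    also have "\<dots> = (\<Sum>b\<in>Basis. (x \<bullet> b) * (y \<bullet> b))"
    proof (rule sum.cong[OF refl])
      fix b :: 'a assume b: "b \<in> Basis"
      have "(\<Sum>b'\<in>Basis. (x \<bullet> b) * ((y \<bullet> b') * (\<sigma> b \<bullet> \<sigma> b')))
          = (\<Sum>b'\<in>Basis. if b' = b then (x \<bullet> b) * (y \<bullet> b) else 0)"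
        by (rule sum.cong[OF refl]) (auto simp: inner_\<sigma> b)
      then show "(\<Sum>b'\<in>Basis. (x \<bullet> b) * ((y \<bullet> b') * (\<sigma> b \<bullet> \<sigma> b'))) = (x \<bullet> b) * (y \<bullet> b)"
        using b by simp
    qed
    finally show ?thesis by (simp add: euclidean_inner[of x y])
  qed
  moreover have "linear T"
    by (rule linearI) (simp_all add: T_def inner_add_left scaleR_add_left sum.distrib scaleR_sum_right)
  ultimately have orth: "orthogonal_transformation T"
    by (simp add: orthogonal_transformation_def)
  interpret product_sigma_finite "\<lambda>_::'a. lborel :: real measure" ..
  let ?R = "\<lambda>f. \<lambda>b\<in>Basis. f (\<sigma> b) :: real"
  have \<sigma>_mem [simp]: "b \<in> Basis \<Longrightarrow> \<sigma> b \<in> C" for b using \<sigma> bij_betwE by blast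
  have R [measurable]: "?R \<in> measurable (\<Pi>\<^sub>M b\<in>C. lborel) (\<Pi>\<^sub>M b\<in>Basis. lborel)"
    by (rule measurable_restrict) simp
  have reindex: "distr (\<Pi>\<^sub>M b\<in>C. lborel) (\<Pi>\<^sub>M b\<in>Basis. lborel) ?R = (\<Pi>\<^sub>M b\<in>(Basis::'a set). (lborel::real measure))"
  proof (rule PiM_eqI)
    fix A :: "'a \<Rightarrow> real set" assume A: "\<And>b. b \<in> Basis \<Longrightarrow> A b \<in> sets lborel"
    let ?\<tau> = "inv_into Basis \<sigma>"
    have \<tau>: "c \<in> C \<Longrightarrow> ?\<tau> c \<in> Basis" for c
      by (metis \<sigma> bij_betw_imp_surj_on inv_into_into)
    have \<sigma>\<tau>: "c \<in> C \<Longrightarrow> \<sigma> (?\<tau> c) = c" for c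
      by (metis \<sigma> bij_betw_imp_surj_on f_inv_into_f)
    have \<tau>\<sigma>: "b \<in> Basis \<Longrightarrow> ?\<tau> (\<sigma> b) = b" for b
      by (metis \<sigma> bij_betw_inv_into_left)
    have "?R -` Pi\<^sub>E Basis A \<inter> space (\<Pi>\<^sub>M b\<in>C. lborel) = Pi\<^sub>E C (\<lambda>c. A (?\<tau> c))"
    proof (intro subset_antisym subsetI)
      fix f assume "f \<in> ?R -` Pi\<^sub>E Basis A \<inter> space (\<Pi>\<^sub>M b\<in>C. lborel)"
      then have ext: "f \<in> extensional C" and mem: "\<And>b. b \<in> Basis \<Longrightarrow> f (\<sigma> b) \<in> A b"
        by (auto simp: space_PiM PiE_iff)
      show "f \<in> Pi\<^sub>E C (\<lambda>c. A (?\<tau> c))"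
        using ext mem[OF \<tau>] by (simp add: PiE_iff \<sigma>\<tau>)
    next
      fix f assume f: "f \<in> Pi\<^sub>E C (\<lambda>c. A (?\<tau> c))"
      have "f (\<sigma> b) \<in> A b" if "b \<in> Basis" for b
        using PiE_mem[OF f \<sigma>_mem[OF that]] \<tau>\<sigma>[OF that] by simp
      then show "f \<in> ?R -` Pi\<^sub>E Basis A \<inter> space (\<Pi>\<^sub>M b\<in>C. lborel)"
        using f by (simp add: space_PiM PiE_iff)
    qed
    then have "emeasure (distr (\<Pi>\<^sub>M b\<in>C. lborel) (\<Pi>\<^sub>M b\<in>Basis. lborel) ?R) (Pi\<^sub>E Basis A)
        = emeasure (\<Pi>\<^sub>M b\<in>C. lborel) (Pi\<^sub>E C (\<lambda>c. A (?\<tau> c)))"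
      using A by (subst emeasure_distr) (auto intro!: sets_PiM_I_finite)
    also have "\<dots> = (\<Prod>c\<in>C. emeasure lborel (A (?\<tau> c)))"
      using A \<tau> fin by (intro emeasure_PiM) auto
    also have "\<dots> = (\<Prod>b\<in>Basis. emeasure lborel (A b))"
      by (subst prod.reindex_bij_betw[OF \<sigma>, symmetric]) (simp add: \<tau>\<sigma>)
    finally show "emeasure (distr (\<Pi>\<^sub>M b\<in>C. lborel) (\<Pi>\<^sub>M b\<in>Basis. lborel) ?R) (Pi\<^sub>E Basis A)
        = (\<Prod>b\<in>Basis. emeasure lborel (A b))" .
  qed auto
  have [measurable]: "T \<in> borel_measurable borel"
    unfolding T_def by measurable
  have "(lborel :: 'a measure) = distr lborel borel T"
    using lborel_distr_isometry[OF orth] by simp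
  also have "\<dots> = distr (distr (\<Pi>\<^sub>M b\<in>Basis. lborel) borel (\<lambda>f. \<Sum>b\<in>Basis. f b *\<^sub>R b)) borel T"
    by (simp only: lborel_def[where 'a = 'a, folded lborel_eq_real])
  also have "\<dots> = distr (\<Pi>\<^sub>M b\<in>Basis. lborel) borel (\<lambda>f. \<Sum>b\<in>Basis. f b *\<^sub>R \<sigma> b)"
  proof -
    have "T (\<Sum>b\<in>Basis. f b *\<^sub>R b) = (\<Sum>b\<in>Basis. f b *\<^sub>R \<sigma> b)" for f
      unfolding T_def by (intro sum.cong refl) simp
    then show ?thesis by (subst distr_distr) (simp_all add: comp_def)
  qed
  also have "\<dots> = distr (\<Pi>\<^sub>M b\<in>C. lborel) borel (\<lambda>f. \<Sum>b\<in>Basis. f (\<sigma> b) *\<^sub>R \<sigma> b)"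
  proof -
    have "(\<Sum>b\<in>Basis. ?R f b *\<^sub>R \<sigma> b) = (\<Sum>b\<in>Basis. f (\<sigma> b) *\<^sub>R \<sigma> b)" for f
      by (intro sum.cong refl) simp
    then show ?thesis
      by (subst reindex[symmetric], subst distr_distr[OF _ R]) (simp_all add: comp_def)
  qed
  also have "\<dots> = distr (\<Pi>\<^sub>M b\<in>C. lborel) borel (\<lambda>f. \<Sum>b\<in>C. f b *\<^sub>R b)"
    by (intro distr_cong refl sum.reindex_bij_betw[OF \<sigma>])
  finally show ?thesis ..
qed

section \<open>Slicing by the lines orthogonal to a hyperplane\<close>

text \<open>
  All that the analysis below uses about the Lebesgue measure \<open>N\<close> of the hyperplane through \<open>p\<close>
  with unit normal \<open>u\<close>: it lives on that hyperplane, and Lebesgue measure of the whole space is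
  the product of \<open>N\<close> with length along the normal lines. This isolates the arbitrary
  choice of an orthonormal frame in \<^const>\<open>affine_lborel\<close>.
\<close>
locale hyperplane_slicing =
  fixes N :: "'a::euclidean_space measure" and u p :: 'a
  assumes sets_N [measurable_cong]: "sets N = sets borel"
    and sigma_finite_N: "sigma_finite_measure N"
    and norm_u: "norm u = 1"
    and AE_hyperplane: "AE z in N. u \<bullet> (z - p) = 0"
    and distr_lines: "distr (N \<Otimes>\<^sub>M lborel) borel (\<lambda>(z, t). z + t *\<^sub>R u) = lborel"

text \<open>
  If \<open>(a, B)\<close> is the chosen frame of the hyperplane, then \<open>insert u B\<close> is an orthonormal basis of
  the whole space, so the claim is Fubini for the product measure over \<open>insert u B\<close>, followed by
  the translation by \<open>a\<close>.
\<close>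
lemma hyperplane_slicing_affine_lborel:
  fixes u p :: "'a::euclidean_space"
  assumes u: "norm u = 1"
  shows "hyperplane_slicing (affine_lborel (hyperplane_through u p)) u p"
proof -
  let ?h = "hyperplane_through u p"
  have uu: "u \<bullet> u = 1" using u by (simp add: dot_square_norm)
  have "affine ?h"
    using affine_hyperplane[of u "u \<bullet> p"] by (simp add: hyperplane_through_def inner_diff_right)
  moreover have "?h \<noteq> {}" by (auto simp: hyperplane_through_def intro: exI[of _ p])
  ultimately obtain F where "orthonormal_frame ?h F" using orthonormal_frame_exists by blast
  then have frame: "orthonormal_frame ?h (SOME F. orthonormal_frame ?h F)" by (rule someI)
  obtain a B where aB: "(SOME F. orthonormal_frame ?h F) = (a, B)" by fastforce
  have B: "pairwise orthogonal B" "\<forall>b\<in>B. norm b = 1" and h: "?h = (\<lambda>x. a + x) ` span B"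
    using frame[unfolded aB] unfolding orthonormal_frame_def by auto
  have fin: "finite B" using orthonormal_basis_finite[OF B] by simp
  have h_iff: "u \<bullet> (x - p) = 0 \<longleftrightarrow> x - a \<in> span B" for x
  proof -
    have "x \<in> ?h \<longleftrightarrow> x - a \<in> span B" unfolding h by (auto simp: image_iff algebra_simps) (metis add_diff_cancel_left' diff_add_cancel add.commute)
    then show ?thesis by (simp add: hyperplane_through_def)
  qed
  have a: "u \<bullet> (a - p) = 0" by (simp add: h_iff span_zero)
  have span_iff: "u \<bullet> x = 0 \<longleftrightarrow> x \<in> span B" for x
    using h_iff[of "a + x"] a by (simp add: inner_diff_right inner_add_right)
  have uB: "u \<bullet> b = 0" if "b \<in> B" for b using span_iff that span_base by blast
  have "u \<notin> B" using uB uu by auto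
  have N: "affine_lborel ?h = distr (\<Pi>\<^sub>M b\<in>B. lborel) borel (\<lambda>f. a + (\<Sum>b\<in>B. f b *\<^sub>R b))"
    by (simp add: affine_lborel_def aB)
  have orth: "pairwise orthogonal (insert u B)"
    using B(1) uB by (auto simp: pairwise_insert orthogonal_def inner_commute)
  have unit: "\<forall>b\<in>insert u B. norm b = 1" using B(2) u by simp
  have span: "span (insert u B) = UNIV"
  proof -
    have "x \<in> span (insert u B)" for x
    proof -
      have "x - (u \<bullet> x) *\<^sub>R u \<in> span B"
        using uu by (simp add: span_iff[symmetric] inner_diff_right)
      then show ?thesis by (auto simp: span_breakdown_eq)
    qed
    then show ?thesis by blast
  qed
  interpret product_sigma_finite "\<lambda>_::'a. lborel :: real measure" ..
  have sf: "sigma_finite_measure (affine_lborel ?h)"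
  proof
    show "\<exists>A. countable A \<and> A \<subseteq> sets (affine_lborel ?h) \<and> \<Union>A = space (affine_lborel ?h)
        \<and> (\<forall>X\<in>A. emeasure (affine_lborel ?h) X \<noteq> \<infinity>)"
    proof (intro exI conjI ballI)
      let ?A = "range (\<lambda>n::nat. ball a (real n))"
      show "countable ?A" by simp
      show "?A \<subseteq> sets (affine_lborel ?h)" by (auto simp: N)
      show "\<Union>?A = space (affine_lborel ?h)"
        using reals_Archimedean2 by (auto simp: N)
      fix X assume "X \<in> ?A"
      then obtain n where X: "X = ball a (real n)" by auto
      let ?E = "Pi\<^sub>E B (\<lambda>_. {- real n..real n})"
      have "emeasure (affine_lborel ?h) X
          = emeasure (\<Pi>\<^sub>M b\<in>B. lborel) ((\<lambda>f. a + (\<Sum>b\<in>B. f b *\<^sub>R b)) -` X \<inter> space (\<Pi>\<^sub>M b\<in>B. lborel))"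
        by (simp add: N emeasure_distr X)
      also have "\<dots> \<le> emeasure (\<Pi>\<^sub>M b\<in>B. lborel) ?E"
      proof (rule emeasure_mono)
        show "(\<lambda>f. a + (\<Sum>b\<in>B. f b *\<^sub>R b)) -` X \<inter> space (\<Pi>\<^sub>M b\<in>B. lborel) \<subseteq> ?E"
        proof (clarsimp simp: X space_PiM PiE_iff)
          fix f :: "'a \<Rightarrow> real" and b
          assume f: "dist a (a + (\<Sum>b\<in>B. f b *\<^sub>R b)) < real n" and b: "b \<in> B"
          have "(\<Sum>b\<in>B. f b *\<^sub>R b) \<bullet> b = (\<Sum>b'\<in>B. if b' = b then f b else 0)"
            unfolding inner_sum_left
          proof (rule sum.cong[OF refl])
            fix b' assume b': "b' \<in> B"
            show "f b' *\<^sub>R b' \<bullet> b = (if b' = b then f b else 0)"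
              using B b b' by (auto simp: pairwise_def orthogonal_def dot_square_norm)
          qed
          then have "(\<Sum>b\<in>B. f b *\<^sub>R b) \<bullet> b = f b" using fin b by simp
          then have "\<bar>f b\<bar> \<le> norm (\<Sum>b\<in>B. f b *\<^sub>R b)"
            using Cauchy_Schwarz_ineq2[of "\<Sum>b\<in>B. f b *\<^sub>R b" b] B(2) b by simp
          then show "- real n \<le> f b \<and> f b \<le> real n"
            using f by (auto simp: dist_norm abs_le_iff)
        qed
      qed (auto intro!: sets_PiM_I_finite fin)
      also have "\<dots> < \<infinity>"
        by (subst emeasure_PiM) (auto simp: fin ennreal_power)
      finally show "emeasure (affine_lborel ?h) X \<noteq> \<infinity>" by simp
    qed
  qed
  show ?thesis
  proof
    show sets: "sets (affine_lborel ?h) = sets borel" by (simp add: N)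
    show "norm u = 1" by fact
    have "u \<bullet> (a + (\<Sum>b\<in>B. f b *\<^sub>R b) - p) = 0" for f
      unfolding h_iff by (simp add: span_sum span_scale span_base)
    then show "AE z in affine_lborel ?h. u \<bullet> (z - p) = 0"
      unfolding N by (subst AE_distr_iff) auto
    interpret N: sigma_finite_measure "affine_lborel ?h" by fact
    show "distr (affine_lborel ?h \<Otimes>\<^sub>M lborel) borel (\<lambda>(z, t). z + t *\<^sub>R u) = lborel"
    proof (rule measure_eqI)
      fix X assume "X \<in> sets (distr (affine_lborel ?h \<Otimes>\<^sub>M lborel) borel (\<lambda>(z, t). z + t *\<^sub>R u))"
      then have X [measurable]: "X \<in> sets borel" by simp
      have [measurable_cong]: "sets (affine_lborel ?h) = sets borel" by (rule sets)
      let ?C = "\<lambda>f. \<Sum>b\<in>insert u B. f b *\<^sub>R b"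
      have "emeasure (distr (affine_lborel ?h \<Otimes>\<^sub>M lborel) borel (\<lambda>(z, t). z + t *\<^sub>R u)) X
          = (\<integral>\<^sup>+y. indicator X (case y of (z, t) \<Rightarrow> z + t *\<^sub>R u) \<partial>(affine_lborel ?h \<Otimes>\<^sub>M lborel))"
        by (subst nn_integral_indicator[symmetric], simp, subst nn_integral_distr) auto
      also have "\<dots> = (\<integral>\<^sup>+z. \<integral>\<^sup>+t. indicator X (z + t *\<^sub>R u) \<partial>lborel \<partial>affine_lborel ?h)"
        by (subst lborel.nn_integral_fst[symmetric]) auto
      also have "\<dots> = (\<integral>\<^sup>+f. \<integral>\<^sup>+t. indicator X (a + (\<Sum>b\<in>B. f b *\<^sub>R b) + t *\<^sub>R u) \<partial>lborel \<partial>(\<Pi>\<^sub>M b\<in>B. lborel))"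
        unfolding N by (subst nn_integral_distr) auto
      also have "\<dots> = (\<integral>\<^sup>+f. \<integral>\<^sup>+t. indicator X (a + ?C (f(u := t))) \<partial>lborel \<partial>(\<Pi>\<^sub>M b\<in>B. lborel))"
      proof (intro nn_integral_cong arg_cong[where f = "indicator X"])
        fix f :: "'a \<Rightarrow> real" and t
        have "(\<Sum>b\<in>B. (f(u := t)) b *\<^sub>R b) = (\<Sum>b\<in>B. f b *\<^sub>R b)"
          using \<open>u \<notin> B\<close> by (intro sum.cong) auto
        then show "a + (\<Sum>b\<in>B. f b *\<^sub>R b) + t *\<^sub>R u = a + ?C (f(u := t))"
          using fin \<open>u \<notin> B\<close> by simp
      qed
      also have "\<dots> = (\<integral>\<^sup>+f. indicator X (a + ?C f) \<partial>(\<Pi>\<^sub>M b\<in>insert u B. lborel))"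
        by (rule product_nn_integral_insert[symmetric]) (auto simp: fin \<open>u \<notin> B\<close>)
      also have "\<dots> = (\<integral>\<^sup>+x. indicator X (a + x) \<partial>distr (\<Pi>\<^sub>M b\<in>insert u B. lborel) borel ?C)"
        by (subst nn_integral_distr) auto
      also have "\<dots> = (\<integral>\<^sup>+x. indicator X x \<partial>distr lborel borel ((+) a))"
        by (subst lborel_orthonormal_basis[OF orth unit span], subst nn_integral_distr) auto
      also have "\<dots> = emeasure lborel X"
        by (simp add: lborel_distr_plus)
      finally show "emeasure (distr (affine_lborel ?h \<Otimes>\<^sub>M lborel) borel (\<lambda>(z, t). z + t *\<^sub>R u)) X
          = emeasure lborel X" .
    qed simp
  qed (fact sigma_finite_measure.sigma_finite_countable[OF sf])
qed

context hyperplane_slicing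
begin

sublocale sigma_finite_measure N by (rule sigma_finite_N)

sublocale lines: pair_sigma_finite N "lborel :: real measure" ..

lemma u_inner_u: "u \<bullet> u = 1"
  using norm_u by (simp add: dot_square_norm)

lemma norm_line_point:
  assumes "u \<bullet> (z - p) = 0"
  shows "(norm (z + t *\<^sub>R u - p))\<^sup>2 = (norm (z - p))\<^sup>2 + t\<^sup>2"
proof -
  have "orthogonal (z - p) (t *\<^sub>R u)"
    using assms by (simp add: orthogonal_def inner_commute[of _ u])
  then show ?thesis
    using norm_add_Pythagorean[of "z - p" "t *\<^sub>R u"] by (simp add: norm_u diff_add_eq)
qed

lemma norm_le_line_point:
  assumes "u \<bullet> (z - p) = 0"
  shows "norm (z - p) \<le> norm (z + t *\<^sub>R u - p)"
  by (rule power2_le_imp_le; simp add: norm_line_point[OF assms])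

lemma nn_integral_lines:
  assumes [measurable]: "f \<in> borel_measurable borel"
  shows "(\<integral>\<^sup>+x. f x \<partial>lborel) = (\<integral>\<^sup>+z. \<integral>\<^sup>+t. f (z + t *\<^sub>R u) \<partial>lborel \<partial>N)"
proof -
  have "(\<integral>\<^sup>+x. f x \<partial>lborel) = (\<integral>\<^sup>+x. f x \<partial>distr (N \<Otimes>\<^sub>M lborel) borel (\<lambda>(z, t). z + t *\<^sub>R u))"
    by (simp add: distr_lines)
  also have "\<dots> = (\<integral>\<^sup>+(z, t). f (z + t *\<^sub>R u) \<partial>(N \<Otimes>\<^sub>M lborel))"
    by (subst nn_integral_distr) (auto simp: case_prod_beta')
  also have "\<dots> = (\<integral>\<^sup>+z. \<integral>\<^sup>+t. f (z + t *\<^sub>R u) \<partial>lborel \<partial>N)"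
    by (subst lborel.nn_integral_fst[symmetric]) auto
  finally show ?thesis .
qed

lemma
  fixes f :: "'a \<Rightarrow> real"
  assumes f: "integrable lborel f"
  shows integrable_lines: "integrable N (\<lambda>z. \<integral>t. f (z + t *\<^sub>R u) \<partial>lborel)"
    and integral_lines: "(\<integral>x. f x \<partial>lborel) = (\<integral>z. \<integral>t. f (z + t *\<^sub>R u) \<partial>lborel \<partial>N)"
proof -
  have [measurable]: "f \<in> borel_measurable borel"
    using borel_measurable_integrable[OF f] by simp
  have "integrable (distr (N \<Otimes>\<^sub>M lborel) borel (\<lambda>(z, t). z + t *\<^sub>R u)) f"
    using f by (simp add: distr_lines)
  then have int: "integrable (N \<Otimes>\<^sub>M lborel) (\<lambda>(z, t). f (z + t *\<^sub>R u))"
    by (subst (asm) integrable_distr_eq) (auto simp: case_prod_beta')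
  show "integrable N (\<lambda>z. \<integral>t. f (z + t *\<^sub>R u) \<partial>lborel)"
    using lines.integrable_fst'[OF int] by simp
  have "(\<integral>x. f x \<partial>lborel) = (\<integral>x. f x \<partial>distr (N \<Otimes>\<^sub>M lborel) borel (\<lambda>(z, t). z + t *\<^sub>R u))"
    by (simp add: distr_lines)
  also have "\<dots> = (\<integral>(z, t). f (z + t *\<^sub>R u) \<partial>(N \<Otimes>\<^sub>M lborel))"
    by (subst integral_distr) (auto simp: case_prod_beta')
  also have "\<dots> = (\<integral>z. \<integral>t. f (z + t *\<^sub>R u) \<partial>lborel \<partial>N)"
    using lines.integral_fst'[OF int] by simp
  finally show "(\<integral>x. f x \<partial>lborel) = (\<integral>z. \<integral>t. f (z + t *\<^sub>R u) \<partial>lborel \<partial>N)" .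
qed

text \<open>
  The cylinder of height 1 over a ball of the hyperplane lies in a slightly larger ball, and its
  volume is the measure of its base.
\<close>
lemma emeasure_cball_finite: "emeasure N (cball p r) < \<infinity>"
proof -
  have "emeasure N (cball p r) = (\<integral>\<^sup>+z. indicator (cball p r) z * (\<integral>\<^sup>+t. indicator {0..1::real} t \<partial>lborel) \<partial>N)"
    by (simp add: sets_N)
  also have "\<dots> \<le> (\<integral>\<^sup>+z. \<integral>\<^sup>+t. indicator (cball p (r + 1)) (z + t *\<^sub>R u) \<partial>lborel \<partial>N)"
  proof (rule nn_integral_mono)
    fix z
    have "z + t *\<^sub>R u \<in> cball p (r + 1)" if "z \<in> cball p r" "t \<in> {0..1}" for t :: real
    proof -
      have "norm (z + t *\<^sub>R u - p) = norm ((z - p) + t *\<^sub>R u)" by (simp add: diff_add_eq)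
      also have "\<dots> \<le> r + 1"
        using that norm_triangle_ineq[of "z - p" "t *\<^sub>R u"] norm_u
        by (simp add: dist_norm norm_minus_commute[of p])
      finally show ?thesis by (simp add: dist_norm norm_minus_commute[of p])
    qed
    then have "(\<integral>\<^sup>+t. indicator (cball p r) z * indicator {0..1::real} t \<partial>lborel)
        \<le> (\<integral>\<^sup>+t. indicator (cball p (r + 1)) (z + t *\<^sub>R u) \<partial>lborel)"
      by (intro nn_integral_mono) (auto simp: indicator_def)
    then show "indicator (cball p r) z * (\<integral>\<^sup>+t. indicator {0..1::real} t \<partial>lborel)
        \<le> (\<integral>\<^sup>+t. indicator (cball p (r + 1)) (z + t *\<^sub>R u) \<partial>lborel)"
      by (subst (asm) nn_integral_cmult) auto
  qed
  also have "\<dots> = emeasure lborel (cball p (r + 1))"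
    by (subst nn_integral_lines[symmetric]) (auto intro!: borel_measurable_indicator)
  also have "\<dots> < \<infinity>"
    using emeasure_lborel_cball_finite[of p "r + 1"] by simp
  finally show ?thesis .
qed

lemma integrable_bounded_support:
  fixes f :: "'a \<Rightarrow> 'b::{banach, second_countable_topology}"
  assumes "f \<in> borel_measurable borel"
    and "AE z in N. norm (f z) \<le> c * indicator (cball p r) z"
  shows "integrable N f"
proof (rule Bochner_Integration.integrable_bound)
  show "integrable N (\<lambda>z. c * indicator (cball p r) z :: real)"
    using emeasure_cball_finite[of r] by (simp add: sets_N)
  show "f \<in> borel_measurable N" using assms(1) by measurable
  show "AE z in N. norm (f z) \<le> norm (c * indicator (cball p r) z :: real)"
    using assms(2) by eventually_elim (auto intro: order_trans)
qed

text \<open>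
  A normal line meets the ball only if its foot point lies in it; if almost no foot point did, the
  ball would have volume 0.
\<close>
lemma emeasure_ball_pos:
  assumes "0 < r"
  shows "emeasure N (ball p r) > 0"
proof -
  have "emeasure N (ball p r) \<noteq> 0"
  proof
    assume 0: "emeasure N (ball p r) = 0"
    have "AE z in N. z \<notin> ball p r"
      using 0 by (intro AE_not_in) (simp add: null_sets_def sets_N)
    then have "AE z in N. (\<integral>\<^sup>+t. indicator (ball p r) (z + t *\<^sub>R u) \<partial>lborel) = 0"
      using AE_hyperplane
    proof eventually_elim
      case (elim z)
      have "z + t *\<^sub>R u \<notin> ball p r" for t
        using elim(1) norm_le_line_point[OF elim(2), of t] by (simp add: dist_norm norm_minus_commute[of p])
      then show ?case by (simp add: indicator_def)
    qed
    then have "(\<integral>\<^sup>+z. \<integral>\<^sup>+t. indicator (ball p r) (z + t *\<^sub>R u) \<partial>lborel \<partial>N) = (\<integral>\<^sup>+z. 0 \<partial>N)"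
      by (rule nn_integral_cong_AE)
    then have "emeasure lborel (ball p r) = 0"
      by (subst (asm) nn_integral_lines[symmetric]) (auto intro!: borel_measurable_indicator)
    then show False
      using open_not_negligible[of "ball p r"] assms
      by (auto simp: negligible_iff_emeasure0 emeasure_completion)
  qed
  then show ?thesis by (simp add: zero_less_iff_neq_zero)
qed

text \<open>
  The points \<open>z - (y \<bullet> (z - p)) u\<close>, for \<open>z\<close> in the hyperplane, form a hyperplane through \<open>p\<close> tilted
  along \<open>y\<close>. It meets the frontier of a convex set around \<open>p\<close> in a null set: let \<open>L\<close> be the
  affine map that projects the space along \<open>u\<close> onto the tilted hyperplane. The preimage under \<open>L\<close>
  of the frontier of \<open>K\<close> is a cylinder contained in the frontier of the convex set \<open>L -` K\<close>, hence
  has volume 0, and a cylinder of volume 0 has a null base.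
\<close>
lemma AE_tilted_hyperplane_notin_frontier:
  assumes K: "closed K" "convex K" "p \<in> interior K"
  shows "AE z in N. z - (y \<bullet> (z - p)) *\<^sub>R u \<notin> frontier K"
proof -
  define M where "M w = w - (u \<bullet> w) *\<^sub>R u - (y \<bullet> (w - (u \<bullet> w) *\<^sub>R u)) *\<^sub>R u" for w
  have lin: "linear M"
    by (rule linearI) (simp_all add: M_def algebra_simps inner_add_right)
  define L where "L x = p + M (x - p)" for x
  define D where "D = {x. L x \<in> frontier K}"
  define C where "C = {x. L x \<in> K}"
  have L_line: "L (z + t *\<^sub>R u) = L z" for z t
    by (simp add: L_def M_def u_inner_u algebra_simps inner_add_right)
  have cont: "continuous_on UNIV L"
    unfolding L_def M_def by (intro continuous_intros)
  have [measurable]: "D \<in> sets borel"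
    unfolding D_def using continuous_closed_vimage[OF frontier_closed, of L K] cont
    by (auto intro!: borel_closed simp: vimage_def continuous_on_eq_continuous_at)
  have "convex C"
  proof (rule convexI)
    fix x x' and a b :: real
    assume x: "x \<in> C" "x' \<in> C" and ab: "0 \<le> a" "0 \<le> b" "a + b = 1"
    have b: "b = 1 - a" using ab(3) by simp
    have "a *\<^sub>R x + b *\<^sub>R x' - p = a *\<^sub>R (x - p) + b *\<^sub>R (x' - p)"
      by (simp add: b algebra_simps)
    then have "L (a *\<^sub>R x + b *\<^sub>R x') = p + (a *\<^sub>R M (x - p) + b *\<^sub>R M (x' - p))"
      by (simp add: L_def linear_add[OF lin] linear_scale[OF lin])
    also have "\<dots> = a *\<^sub>R L x + b *\<^sub>R L x'"
      by (simp add: b L_def algebra_simps)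
    finally show "a *\<^sub>R x + b *\<^sub>R x' \<in> C"
      using x ab K(2) by (simp add: C_def convexD)
  qed
  have "D \<subseteq> frontier C"
  proof
    fix x assume "x \<in> D"
    then have x: "L x \<in> K" "L x \<notin> interior K"
      using K(1) by (auto simp: D_def frontier_def)
    have "x \<notin> interior C"
    proof
      assume "x \<in> interior C"
      then obtain e where e: "e > 0" "ball x e \<subseteq> C" by (auto simp: mem_interior)
      \<comment> \<open>If a point slightly farther from \<open>p\<close> still lies in \<open>C\<close>, then \<open>L x\<close> lies strictly inside a segment from the interior point \<open>p\<close> to a point of \<open>K\<close>.\<close>
      obtain d where d: "d > 0" "d * norm (x - p) < e"
      proof
        show "e / (norm (x - p) + 1) > 0" using e(1) by (simp add: add_nonneg_pos)
        show "e / (norm (x - p) + 1) * norm (x - p) < e"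
          using e(1) add_nonneg_pos[of "norm (x - p)" 1]
          by (simp add: pos_divide_less_eq mult.commute[of e])
      qed
      have "x + d *\<^sub>R (x - p) \<in> ball x e" using d by (simp add: dist_norm)
      then have "L (x + d *\<^sub>R (x - p)) \<in> K" using e(2) by (auto simp: C_def)
      moreover have "x + d *\<^sub>R (x - p) - p = (1 + d) *\<^sub>R (x - p)" by (simp add: algebra_simps)
      then have "L (x + d *\<^sub>R (x - p)) = p + (1 + d) *\<^sub>R (L x - p)"
        by (simp add: L_def linear_scale[OF lin])
      ultimately have "p + (1 + d) *\<^sub>R (L x - p) \<in> K" by simp
      then have "p + (1 + d) *\<^sub>R (L x - p) - (d / (1 + d)) *\<^sub>R (p + (1 + d) *\<^sub>R (L x - p) - p) \<in> interior K"
        using d K by (intro mem_interior_convex_shrink) auto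
      also have "p + (1 + d) *\<^sub>R (L x - p) - (d / (1 + d)) *\<^sub>R (p + (1 + d) *\<^sub>R (L x - p) - p) = L x"
      proof -
        have shrink: "(d / (1 + d)) *\<^sub>R (p + (1 + d) *\<^sub>R w - p) = d *\<^sub>R w" for w :: 'a
          using d(1) by simp
        show ?thesis unfolding shrink by (simp add: scaleR_add_left)
      qed
      finally show False using x by simp
    qed
    then show "x \<in> frontier C"
      using x closure_subset[of C] by (auto simp: frontier_def C_def)
  qed
  then have "negligible D"
    using negligible_convex_frontier[OF \<open>convex C\<close>] negligible_subset by blast
  then have "emeasure lborel D = 0"
    by (simp add: negligible_iff_emeasure0 emeasure_completion)
  then have "(\<integral>\<^sup>+z. \<integral>\<^sup>+t. indicator D (z + t *\<^sub>R u) \<partial>lborel \<partial>N) = 0"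
    by (subst nn_integral_lines[symmetric]) auto
  moreover have "(\<integral>\<^sup>+t. indicator D (z + t *\<^sub>R u) \<partial>(lborel :: real measure)) = indicator D z * \<infinity>" for z
    by (simp add: D_def indicator_def L_line)
  ultimately have "(\<integral>\<^sup>+z. indicator D z * \<infinity> \<partial>N) = 0" by simp
  then have "AE z in N. z \<notin> D"
    by (subst (asm) nn_integral_0_iff_AE) (auto simp: indicator_def split: if_splits)
  then show ?thesis
    using AE_hyperplane
  proof eventually_elim
    case (elim z)
    then show ?case by (simp add: D_def L_def M_def)
  qed
qed

end

section \<open>Chords of a convex body\<close>

locale sliced_convex_body = hyperplane_slicing N u p
  for N :: "'a::euclidean_space measure" and u p +
  fixes K :: "'a set"
  assumes compact: "compact K" and convex: "convex K" and center: "p \<in> interior K"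
begin

lemma borel_K [measurable]: "K \<in> sets borel"
  by (rule borel_closed[OF compact_imp_closed[OF compact]])

text \<open>
  Any bound will do; it only serves to dominate the integrands below.
\<close>
definition radius :: real where
  "radius = (SOME r. K \<subseteq> cball p r)"

lemma K_subset_cball: "K \<subseteq> cball p radius"
proof -
  obtain r where "K \<subseteq> cball p r"
    using compact_imp_bounded[OF compact] bounded_any_center[of K p] by (auto simp: subset_iff)
  then show ?thesis unfolding radius_def by (rule someI)
qed

lemma radius_nonneg: "0 \<le> radius"
  using K_subset_cball center interior_subset[of K] by fastforce

lemma line_meets_K:
  assumes "u \<bullet> (z - p) = 0" "z + t *\<^sub>R u \<in> K"
  shows "z \<in> cball p radius"
proof -
  have "norm (z + t *\<^sub>R u - p) \<le> radius"
    using assms(2) K_subset_cball by (auto simp: dist_norm norm_minus_commute)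
  then show ?thesis
    using norm_le_line_point[OF assms(1), of t] by (simp add: dist_norm norm_minus_commute[of p])
qed

text \<open>
  The length of the part above height \<open>- s\<close> of the chord of \<open>K\<close> through \<open>z\<close> in direction \<open>u\<close>. For
  \<open>z\<close> in the hyperplane and \<open>y\<close> orthogonal to \<open>u\<close>, the point \<open>z + t u\<close> lies in the half-space with
  normal \<open>u + y\<close> exactly if \<open>t \<ge> - s\<close> with \<open>s = y \<bullet> (z - p)\<close>; hence the sign.
\<close>
definition chord_length :: "'a \<Rightarrow> real \<Rightarrow> real" where
  "chord_length z s = (\<integral>t. indicator K (z + t *\<^sub>R u) * indicator {-s..} t \<partial>lborel)"

lemma integrable_line:
  assumes [measurable]: "A \<in> sets borel"
  shows "integrable lborel (\<lambda>t::real. indicator K (z + t *\<^sub>R u) * indicator A t :: real)"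
proof -
  let ?T = "{t. z + t *\<^sub>R u \<in> K \<and> t \<in> A}"
  have "?T \<subseteq> cball 0 (radius + norm (z - p))"
  proof
    fix t assume "t \<in> ?T"
    then have "norm (z + t *\<^sub>R u - p) \<le> radius"
      using K_subset_cball by (auto simp: dist_norm norm_minus_commute)
    then have "norm (t *\<^sub>R u) \<le> radius + norm (z - p)"
      using norm_triangle_ineq4[of "z + t *\<^sub>R u - p" "z - p"] by simp
    then show "t \<in> cball 0 (radius + norm (z - p))"
      by (simp add: norm_u)
  qed
  then have "bounded ?T" using bounded_cball bounded_subset by blast
  then have "emeasure lborel ?T < \<infinity>" by (rule emeasure_bounded_finite)
  then have "integrable lborel (indicator ?T :: real \<Rightarrow> real)"
    by (intro integrable_real_indicator) auto
  moreover have "indicator ?T = (\<lambda>t::real. indicator K (z + t *\<^sub>R u) * indicator A t :: real)"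
    by (auto simp: indicator_def)
  ultimately show ?thesis by simp
qed

lemma chord_length_diff:
  assumes "s \<le> s'"
  shows "chord_length z s' - chord_length z s
    = (\<integral>t. indicator K (z + t *\<^sub>R u) * indicator {-s'..<-s} t \<partial>lborel)"
proof -
  have "chord_length z s' - chord_length z s
      = (\<integral>t. indicator K (z + t *\<^sub>R u) * indicator {-s'..} t
            - indicator K (z + t *\<^sub>R u) * indicator {-s..} t \<partial>lborel)"
    unfolding chord_length_def by (rule Bochner_Integration.integral_diff[symmetric]) (auto intro: integrable_line)
  also have "\<dots> = (\<integral>t. indicator K (z + t *\<^sub>R u) * indicator {-s'..<-s} t \<partial>lborel)"
    using assms by (intro Bochner_Integration.integral_cong) (auto simp: indicator_def)
  finally show ?thesis .
qed

lemma chord_length_Lipschitz: "\<bar>chord_length z s' - chord_length z s\<bar> \<le> \<bar>s' - s\<bar>"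
proof -
  have *: "\<bar>chord_length z s' - chord_length z s\<bar> \<le> s' - s" if "s \<le> s'" for s s'
  proof -
    have "(\<integral>t. indicator K (z + t *\<^sub>R u) * indicator {-s'..<-s} t \<partial>lborel)
        \<le> (\<integral>t. indicator {-s'..<-s} t \<partial>lborel :: real)"
    proof (rule integral_mono)
      show "integrable lborel (\<lambda>t::real. indicator K (z + t *\<^sub>R u) * indicator {-s'..<-s} t :: real)"
        by (rule integrable_line) simp
      show "integrable lborel (indicator {-s'..<-s} :: real \<Rightarrow> real)"
        using that by (intro integrable_real_indicator) auto
    qed (auto simp: indicator_def)
    moreover have "(\<integral>t. indicator K (z + t *\<^sub>R u) * indicator {-s'..<-s} t \<partial>lborel) \<ge> (0::real)"
      by (intro integral_nonneg_AE) auto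
    ultimately show ?thesis using that by (simp add: chord_length_diff)
  qed
  show ?thesis using *[of s s'] *[of s' s] by (cases "s \<le> s'") auto
qed

text \<open>
  Away from the frontier of \<open>K\<close>, moving the cut by a small amount adds or removes a full segment of
  the chord if the cut is inside \<open>K\<close>, and nothing if it is outside.
\<close>
lemma chord_length_locally_affine:
  assumes "z - s *\<^sub>R u \<notin> frontier K"
  shows "\<forall>\<^sub>F s' in nhds s. chord_length z s' - chord_length z s = indicator K (z - s *\<^sub>R u) * (s' - s)"
proof -
  let ?c = "indicator K (z - s *\<^sub>R u) :: real"
  define U where "U = (if z - s *\<^sub>R u \<in> K then interior K else - K)"
  have "open U" "z - s *\<^sub>R u \<in> U"
    using assms compact_imp_closed[OF compact]
    by (auto simp: U_def frontier_def)
  then obtain e where e: "e > 0" "ball (z - s *\<^sub>R u) e \<subseteq> U" by (meson openE)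
  have c: "indicator K (z + t *\<^sub>R u) = ?c" if "\<bar>t + s\<bar> < e" for t
  proof -
    have "z - s *\<^sub>R u - (z + t *\<^sub>R u) = - ((t + s) *\<^sub>R u)" by (simp add: algebra_simps)
    then have "dist (z - s *\<^sub>R u) (z + t *\<^sub>R u) = \<bar>t + s\<bar>"
      by (simp add: dist_norm norm_u)
    then have "z + t *\<^sub>R u \<in> U" using e(2) that by auto
    then show ?thesis using interior_subset[of K] by (auto simp: U_def indicator_def split: if_splits)
  qed
  have eq: "chord_length z b - chord_length z a = ?c * (b - a)"
    if "a \<le> b" "\<bar>a - s\<bar> < e" "\<bar>b - s\<bar> < e" for a b
  proof -
    have "chord_length z b - chord_length z a = (\<integral>t. ?c * indicator {-b..<-a} t \<partial>lborel)"
      unfolding chord_length_diff[OF that(1)]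
      using that c by (intro Bochner_Integration.integral_cong) (auto simp: indicator_def)
    then show ?thesis using that(1) by simp
  qed
  have "chord_length z s' - chord_length z s = ?c * (s' - s)" if "dist s' s < e" for s'
  proof (cases "s \<le> s'")
    case True
    then show ?thesis using eq[of s s'] that e(1) by (simp add: dist_real_def)
  next
    case False
    then show ?thesis using eq[of s' s] that e(1) by (simp add: dist_real_def algebra_simps)
  qed
  then show ?thesis using e(1) by (auto simp: eventually_nhds_metric)
qed

section \<open>The volume of a cap and its gradient\<close>

text \<open>
  For \<open>y\<close> orthogonal to \<open>u\<close> this is the volume of the cap of \<open>K\<close> cut off by the half-space with
  normal \<open>u + y\<close>. The formula makes sense for every \<open>y\<close>, so that it can be
  differentiated in the whole space instead of in the subspace of directions orthogonal to \<open>u\<close>.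
\<close>
definition cap_volume :: "'a \<Rightarrow> real" where
  "cap_volume y = (\<integral>z. chord_length z (y \<bullet> (z - p)) \<partial>N)"

text \<open>
  The first moment about \<open>p\<close> of the projection along \<open>u\<close> of the section of \<open>K\<close> by the tilted
  hyperplane. It turns out to be the gradient of \<^const>\<open>cap_volume\<close>.
\<close>
definition section_moment :: "'a \<Rightarrow> 'a" where
  "section_moment y = (\<integral>z. indicator K (z - (y \<bullet> (z - p)) *\<^sub>R u) *\<^sub>R (z - p) \<partial>N)"

text \<open>
  Both facts come from integrating the indicator of \<open>H\<close> along the normal lines. For \<open>y\<close>
  orthogonal to \<open>u\<close> the set \<open>H\<close> is the cap; its defining inequality is written so that it reads
  \<open>y \<bullet> (z - p) + t \<ge> 0\<close> at \<open>z + t u\<close> for every \<open>y\<close>.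
\<close>
lemma
  fixes y :: 'a
  shows integrable_chord_length: "integrable N (\<lambda>z. chord_length z (y \<bullet> (z - p)))"
    and cap_volume_eq_measure:
      "u \<bullet> y = 0 \<Longrightarrow> cap_volume y = measure lebesgue (halfspace_through (u + y) p \<inter> K)"
proof -
  define H where "H = {x. y \<bullet> (x - (u \<bullet> (x - p)) *\<^sub>R u - p) + u \<bullet> (x - p) \<ge> 0} \<inter> K"
  have [measurable]: "H \<in> sets borel" unfolding H_def by measurable
  have "bounded H" unfolding H_def
    using compact compact_imp_bounded bounded_Int by blast
  then have int: "integrable lborel (indicator H :: 'a \<Rightarrow> real)"
    by (intro integrable_real_indicator emeasure_bounded_finite) auto
  have chord: "AE z in N. (\<integral>t. indicator H (z + t *\<^sub>R u) \<partial>lborel) = chord_length z (y \<bullet> (z - p))"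
    using AE_hyperplane
  proof eventually_elim
    case (elim z)
    have "u \<bullet> (z + t *\<^sub>R u - p) = t" for t
      using elim u_inner_u by (simp add: inner_add_right inner_diff_right)
    then show ?case
      unfolding chord_length_def
      by (intro Bochner_Integration.integral_cong) (auto simp: H_def indicator_def)
  qed
  have [measurable]: "(\<lambda>z. chord_length z (y \<bullet> (z - p))) \<in> borel_measurable N"
  proof -
    \<comment> \<open>Moving the parameter out of the interval makes joint measurability in \<open>z\<close> and \<open>t\<close> visible.\<close>
    have "chord_length z s = (\<integral>t. indicator K (z + t *\<^sub>R u) * indicator {0..} (t + s) \<partial>lborel)" for z s
      unfolding chord_length_def
      by (intro Bochner_Integration.integral_cong) (auto simp: indicator_def)
    then show ?thesis by simp
  qed
  show "integrable N (\<lambda>z. chord_length z (y \<bullet> (z - p)))"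
    using integrable_lines[OF int] chord by (subst integrable_cong_AE[symmetric]) auto
  assume y: "u \<bullet> y = 0"
  have "H = halfspace_through (u + y) p \<inter> K"
    using y by (auto simp: H_def halfspace_through_def inner_diff_right inner_add_left inner_add_right inner_commute[of y u])
  moreover have "cap_volume y = measure lborel H"
    using integral_lines[OF int] chord unfolding cap_volume_def
    by (subst integral_cong_AE[symmetric, OF _ _ chord]) auto
  moreover have "measure lebesgue H = measure lborel H"
    by (rule measure_completion) simp
  ultimately show "cap_volume y = measure lebesgue (halfspace_through (u + y) p \<inter> K)"
    by simp
qed

lemma integrable_section_moment:
  "integrable N (\<lambda>z. indicator K (z - (y \<bullet> (z - p)) *\<^sub>R u) *\<^sub>R (z - p))"
proof (rule integrable_bounded_support[where c = radius and r = radius])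
  show "AE z in N. norm (indicator K (z - (y \<bullet> (z - p)) *\<^sub>R u) *\<^sub>R (z - p))
      \<le> radius * indicator (cball p radius) z"
    using AE_hyperplane
  proof eventually_elim
    case (elim z)
    then show ?case
      using line_meets_K[of z "- (y \<bullet> (z - p))"] radius_nonneg
      by (auto simp: indicator_def dist_norm norm_minus_commute)
  qed
qed measurable

lemma AE_chord_length_zero:
  "AE z in N. z \<notin> cball p radius \<longrightarrow> (\<forall>s. chord_length z s = 0 \<and> z - s *\<^sub>R u \<notin> K)"
  using AE_hyperplane
proof eventually_elim
  case (elim z)
  have "z + t *\<^sub>R u \<notin> K" if "z \<notin> cball p radius" for t
    using line_meets_K[OF elim] that by blast
  from this this[of "- t" for t] show ?case by (auto simp: chord_length_def indicator_def)
qed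

text \<open>
  Dominated convergence: the integrand at \<open>z\<close> is continuous in \<open>y\<close> unless the tilted hyperplane
  passes through the frontier of \<open>K\<close> above \<open>z\<close>, which happens only for a null set of \<open>z\<close>.
\<close>
lemma continuous_section_moment: "continuous_on UNIV section_moment"
proof -
  have "isCont section_moment y" for y
    unfolding continuous_at_sequentially
  proof (intro allI impI)
    fix X :: "nat \<Rightarrow> 'a" assume X: "X \<longlonglongrightarrow> y"
    let ?f = "\<lambda>y z. indicator K (z - (y \<bullet> (z - p)) *\<^sub>R u) *\<^sub>R (z - p)"
    show "(section_moment \<circ> X) \<longlonglongrightarrow> section_moment y"
      unfolding comp_def section_moment_def
    proof (rule integral_dominated_convergence)
      show "?f y \<in> borel_measurable N" "\<And>i. ?f (X i) \<in> borel_measurable N" by measurable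
      show "integrable N (\<lambda>z. radius * indicator (cball p radius) z :: real)"
        using emeasure_cball_finite[of radius] by (simp add: sets_N)
      show "AE z in N. norm (?f (X i) z) \<le> radius * indicator (cball p radius) z" for i
        using AE_chord_length_zero
      proof eventually_elim
        case (elim z)
        then show ?case using radius_nonneg by (auto simp: indicator_def dist_norm norm_minus_commute)
      qed
      show "AE z in N. (\<lambda>i. ?f (X i) z) \<longlonglongrightarrow> ?f y z"
        using AE_tilted_hyperplane_notin_frontier[OF compact_imp_closed[OF compact] convex center, of y]
      proof eventually_elim
        case (elim z)
        have "isCont (\<lambda>x. indicator K x :: real) (z - (y \<bullet> (z - p)) *\<^sub>R u)"
          using elim by (simp add: isCont_indicator)
        moreover have "(\<lambda>i. z - (X i \<bullet> (z - p)) *\<^sub>R u) \<longlonglongrightarrow> z - (y \<bullet> (z - p)) *\<^sub>R u"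
          by (intro tendsto_intros X)
        ultimately have "(\<lambda>i. indicator K (z - (X i \<bullet> (z - p)) *\<^sub>R u) :: real) \<longlonglongrightarrow> indicator K (z - (y \<bullet> (z - p)) *\<^sub>R u)"
          by (rule isCont_tendsto_compose)
        then show ?case by (intro tendsto_intros)
      qed
    qed
  qed
  then show ?thesis by (simp add: continuous_at_imp_continuous_on)
qed

text \<open>
  Differentiation under the integral. The difference quotients of the chord lengths minus their
  proposed linear part are bounded, by the Lipschitz property, and for almost every \<open>z\<close> they
  vanish as soon as the increment is small, because the chord length is locally affine.
\<close>
lemma cap_volume_has_derivative:
  "(cap_volume has_derivative (\<lambda>h. section_moment y \<bullet> h)) (at y)"
  unfolding has_derivative_iff_norm tendsto_at_iff_sequentially
proof (intro conjI allI impI)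
  show "bounded_linear (\<lambda>h. section_moment y \<bullet> h)" by (rule bounded_linear_inner_right)
  fix X :: "nat \<Rightarrow> 'a" assume "\<forall>i. X i \<in> UNIV - {y}" and X: "X \<longlonglongrightarrow> y"
  then have ne: "X i \<noteq> y" for i by auto
  let ?c = "\<lambda>z. indicator K (z - (y \<bullet> (z - p)) *\<^sub>R u) :: real"
  define q where "q i z = (chord_length z (X i \<bullet> (z - p)) - chord_length z (y \<bullet> (z - p))
    - (?c z *\<^sub>R (z - p)) \<bullet> (X i - y)) / norm (X i - y)" for i z
  have int: "integrable N (q i)" for i
    unfolding q_def
    by (intro integrable_divide Bochner_Integration.integrable_diff integrable_chord_length
        integrable_inner_left integrable_section_moment)
  have int_q: "(cap_volume (X i) - cap_volume y - section_moment y \<bullet> (X i - y)) / norm (X i - y) = (\<integral>z. q i z \<partial>N)" for i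
  proof -
    have "(\<integral>z. q i z \<partial>N) = ((\<integral>z. chord_length z (X i \<bullet> (z - p)) \<partial>N) - (\<integral>z. chord_length z (y \<bullet> (z - p)) \<partial>N)
        - (\<integral>z. (?c z *\<^sub>R (z - p)) \<bullet> (X i - y) \<partial>N)) / norm (X i - y)"
      unfolding q_def integral_divide_zero
      using integrable_chord_length[of "X i"] integrable_chord_length[of y]
        integrable_inner_left[OF integrable_section_moment[of y], of "X i - y"]
      by (simp only: Bochner_Integration.integral_diff Bochner_Integration.integrable_diff)
    also have "(\<integral>z. (?c z *\<^sub>R (z - p)) \<bullet> (X i - y) \<partial>N) = section_moment y \<bullet> (X i - y)"
      unfolding section_moment_def
      by (rule integral_inner_left) (rule integrable_section_moment)
    finally show ?thesis by (simp add: cap_volume_def)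
  qed
  have "(\<lambda>i. \<integral>z. q i z \<partial>N) \<longlonglongrightarrow> (\<integral>z. 0 \<partial>N)"
  proof (rule integral_dominated_convergence)
    show "q i \<in> borel_measurable N" for i using int by auto
    show "integrable N (\<lambda>z. (2 * radius) * indicator (cball p radius) z :: real)"
      using emeasure_cball_finite[of radius] by (simp add: sets_N)
    show "AE z in N. norm (q i z) \<le> (2 * radius) * indicator (cball p radius) z" for i
      using AE_chord_length_zero
    proof eventually_elim
      case (elim z)
      show ?case
      proof (cases "z \<in> cball p radius")
        case False
        then show ?thesis using elim by (simp add: q_def)
      next
        case True
        have "\<bar>chord_length z (X i \<bullet> (z - p)) - chord_length z (y \<bullet> (z - p))\<bar> \<le> \<bar>X i \<bullet> (z - p) - y \<bullet> (z - p)\<bar>"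
          by (rule chord_length_Lipschitz)
        also have "\<dots> = \<bar>(z - p) \<bullet> (X i - y)\<bar>"
          by (simp add: inner_diff_left inner_diff_right inner_commute)
        finally have "\<bar>chord_length z (X i \<bullet> (z - p)) - chord_length z (y \<bullet> (z - p)) - (?c z *\<^sub>R (z - p)) \<bullet> (X i - y)\<bar>
            \<le> 2 * \<bar>(z - p) \<bullet> (X i - y)\<bar>"
          by (auto simp: indicator_def)
        also have "\<dots> \<le> 2 * (norm (z - p) * norm (X i - y))"
          by (simp add: Cauchy_Schwarz_ineq2)
        also have "\<dots> \<le> 2 * radius * norm (X i - y)"
          using True by (simp add: mult_right_mono dist_norm norm_minus_commute)
        finally show ?thesis using True ne[of i] by (simp add: q_def pos_divide_le_eq)
      qed
    qed
    show "AE z in N. (\<lambda>i. q i z) \<longlonglongrightarrow> 0"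
      using AE_tilted_hyperplane_notin_frontier[OF compact_imp_closed[OF compact] convex center, of y]
    proof eventually_elim
      case (elim z)
      have "(\<lambda>i. X i \<bullet> (z - p)) \<longlonglongrightarrow> y \<bullet> (z - p)"
        by (intro tendsto_intros X)
      then have "\<forall>\<^sub>F i in sequentially. chord_length z (X i \<bullet> (z - p)) - chord_length z (y \<bullet> (z - p))
          = ?c z * (X i \<bullet> (z - p) - y \<bullet> (z - p))"
        using chord_length_locally_affine[OF elim] unfolding filterlim_iff by blast
      then have "\<forall>\<^sub>F i in sequentially. q i z = 0"
        by eventually_elim (simp add: q_def inner_diff_left inner_diff_right inner_commute)
      then show ?case by (rule tendsto_eventually)
    qed
  qed auto
  then have "(\<lambda>i. norm (\<integral>z. q i z \<partial>N)) \<longlonglongrightarrow> 0"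
    by (intro tendsto_norm_zero) simp
  then show "((\<lambda>x. norm (cap_volume x - cap_volume y - section_moment y \<bullet> (x - y)) / norm (x - y)) \<circ> X) \<longlonglongrightarrow> 0"
    by (simp add: comp_def int_q[symmetric])
qed

text \<open>
  For \<open>y = 0\<close> the hyperplane is not tilted, and the moment of a set within the hyperplane is
  parallel to it.
\<close>
lemma section_moment_0:
  "section_moment 0 = (\<integral>z\<in>K \<inter> hyperplane_through u p. (z - p) \<partial>N)" and
  section_moment_0_orthogonal: "u \<bullet> section_moment 0 = 0"
proof -
  show "section_moment 0 = (\<integral>z\<in>K \<inter> hyperplane_through u p. (z - p) \<partial>N)"
    unfolding section_moment_def set_lebesgue_integral_def
  proof (rule integral_cong_AE)
    show "AE z in N. indicator K (z - (0 \<bullet> (z - p)) *\<^sub>R u) *\<^sub>R (z - p) =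
         indicator (K \<inter> hyperplane_through u p) z *\<^sub>R (z - p)"
      using AE_hyperplane by eventually_elim (simp add: indicator_def hyperplane_through_def)
  qed (unfold hyperplane_through_def, measurable)
  have "u \<bullet> section_moment 0 = (\<integral>z. u \<bullet> (indicator K (z - (0 \<bullet> (z - p)) *\<^sub>R u) *\<^sub>R (z - p)) \<partial>N)"
    unfolding section_moment_def by (rule integral_inner_right[symmetric]) (rule integrable_section_moment)
  also have "\<dots> = (\<integral>z. 0 \<partial>N)"
    using AE_hyperplane by (intro integral_cong_AE) auto
  finally show "u \<bullet> section_moment 0 = 0" by simp
qed

end

section \<open>The depth function in a chart of the sphere\<close>

lemma halfspace_through_scaleR:
  "0 < c \<Longrightarrow> halfspace_through (c *\<^sub>R v) p = halfspace_through v p"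
  by (simp add: halfspace_through_def zero_le_mult_iff)

text \<open>
  Rescaling the unit vector \<open>x + s u\<close> of the chart at \<open>u\<close>, where \<open>s\<close> is the square root of
  \<open>1 - (norm x)\<^sup>2\<close>, so that its \<open>u\<close>-component becomes 1 gives the normal \<open>u + (1 / s) x\<close>.
  This map turns the graph chart into the slope parameter \<open>y\<close> of \<open>cap_volume\<close>.
\<close>
lemma has_derivative_gnomonic:
  fixes x :: "'a::euclidean_space"
  assumes "norm x < 1"
  defines "s \<equiv> sqrt (1 - (norm x)\<^sup>2)"
  shows "((\<lambda>x. (1 / sqrt (1 - (norm x)\<^sup>2)) *\<^sub>R x) has_derivative
    (\<lambda>h. (1 / s) *\<^sub>R h + ((x \<bullet> h) / s ^ 3) *\<^sub>R x)) (at x)"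
proof -
  have pos: "0 < 1 - (norm x)\<^sup>2"
    using assms(1) by (simp add: abs_square_less_1)
  then have s: "0 < s" by (simp add: s_def)
  have "((\<lambda>x. 1 - x \<bullet> x) has_derivative (\<lambda>h. - (2 * (x \<bullet> h)))) (at x)"
    by (auto intro!: derivative_eq_intros simp: inner_commute)
  moreover have "((\<lambda>q. 1 / sqrt q) has_real_derivative (- (1 / (2 * s ^ 3)))) (at (1 - x \<bullet> x))"
    using pos s unfolding power2_norm_eq_inner s_def
    by (auto intro!: derivative_eq_intros simp: divide_simps power3_eq_cube power2_eq_square)
  ultimately have "((\<lambda>x. 1 / sqrt (1 - x \<bullet> x)) has_derivative
      (\<lambda>h. - (2 * (x \<bullet> h)) * (- (1 / (2 * s ^ 3))))) (at x)"
    by (rule DERIV_compose_FDERIV[rotated])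
  then have "((\<lambda>x. 1 / sqrt (1 - x \<bullet> x)) has_derivative (\<lambda>h. (x \<bullet> h) / s ^ 3)) (at x)"
    by simp
  from has_derivative_scaleR[OF this has_derivative_ident]
  show ?thesis by (simp add: power2_norm_eq_inner s_def)
qed

context sliced_convex_body
begin

text \<open>
  The chain rule for \<^const>\<open>cap_volume\<close> and the rescaling map, written as a vector so that
  continuity of the derivative is continuity of a vector field.
\<close>
definition depth_gradient :: "'a \<Rightarrow> 'a" where
  "depth_gradient x = (let s = sqrt (1 - (norm x)\<^sup>2); g = section_moment ((1 / s) *\<^sub>R x) in
     (1 / measure lebesgue K) *\<^sub>R ((1 / s) *\<^sub>R g + ((g \<bullet> x) / s ^ 3) *\<^sub>R x))"

lemma depth_sphere_param:
  assumes x: "x \<in> chart_ball u"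
  shows "depth K p (sphere_param u x)
    = cap_volume ((1 / sqrt (1 - (norm x)\<^sup>2)) *\<^sub>R x) / measure lebesgue K"
proof -
  define s where "s = sqrt (1 - (norm x)\<^sup>2)"
  have "norm x < 1" "u \<bullet> x = 0" using x by (auto simp: chart_ball_def tangent_space_def)
  then have s: "0 < s" by (simp add: s_def abs_square_less_1)
  have "sphere_param u x = s *\<^sub>R (u + (1 / s) *\<^sub>R x)"
    using s by (simp add: sphere_param_def s_def scaleR_add_right)
  then have "depth K p (sphere_param u x)
      = measure lebesgue (halfspace_through (u + (1 / s) *\<^sub>R x) p \<inter> K) / measure lebesgue K"
    by (simp only: depth_def halfspace_through_scaleR[OF s])
  also have "\<dots> = cap_volume ((1 / s) *\<^sub>R x) / measure lebesgue K"
    using \<open>u \<bullet> x = 0\<close> by (simp add: cap_volume_eq_measure)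
  finally show ?thesis by (simp add: s_def)
qed

lemma depth_has_derivative:
  assumes x: "x \<in> chart_ball u"
  shows "((depth K p \<circ> sphere_param u) has_derivative (\<lambda>h. depth_gradient x \<bullet> h)) (at x within chart_ball u)"
proof -
  define s where "s = sqrt (1 - (norm x)\<^sup>2)"
  let ?\<eta> = "\<lambda>x. (1 / sqrt (1 - (norm x)\<^sup>2)) *\<^sub>R x :: 'a"
  define g where "g = section_moment (?\<eta> x)"
  have "norm x < 1" using x by (simp add: chart_ball_def)
  then have "((\<lambda>x. cap_volume (?\<eta> x)) has_derivative
      (\<lambda>h. g \<bullet> ((1 / s) *\<^sub>R h + ((x \<bullet> h) / s ^ 3) *\<^sub>R x))) (at x)"
    unfolding s_def g_def
    by (rule has_derivative_compose[OF has_derivative_gnomonic cap_volume_has_derivative])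
  from bounded_linear.has_derivative[OF bounded_linear_divide this, of "measure lebesgue K"]
  have "((\<lambda>x. cap_volume (?\<eta> x) / measure lebesgue K) has_derivative
      (\<lambda>h. g \<bullet> ((1 / s) *\<^sub>R h + ((x \<bullet> h) / s ^ 3) *\<^sub>R x) / measure lebesgue K)) (at x within chart_ball u)"
    by (rule has_derivative_at_withinI)
  moreover have "g \<bullet> ((1 / s) *\<^sub>R h + ((x \<bullet> h) / s ^ 3) *\<^sub>R x) / measure lebesgue K = depth_gradient x \<bullet> h" for h
    by (simp add: depth_gradient_def Let_def s_def g_def inner_add_left inner_add_right)
  ultimately have deriv: "((\<lambda>x. cap_volume (?\<eta> x) / measure lebesgue K) has_derivative
      (\<lambda>h. depth_gradient x \<bullet> h)) (at x within chart_ball u)"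
    by (simp only:)
  show ?thesis
    by (rule has_derivative_transform[OF x _ deriv]) (simp add: depth_sphere_param)
qed

lemma C1_on_depth: "C1_on (depth K p \<circ> sphere_param u) (chart_ball u)"
proof -
  have "continuous_on (chart_ball u) depth_gradient"
    unfolding depth_gradient_def Let_def
    by (intro continuous_intros continuous_on_compose2[OF continuous_section_moment])
      (auto simp: chart_ball_def abs_square_eq_1)
  then have "continuous_on (chart_ball u) (\<lambda>x. blinfun_inner_right (depth_gradient x))"
    by (intro bounded_linear.continuous_on[OF bounded_linear_blinfun_inner_right])
  then show ?thesis
    unfolding C1_on_def using depth_has_derivative
    by (intro exI[of _ "\<lambda>x. blinfun_inner_right (depth_gradient x)"]) auto
qed

lemma measure_K_pos: "0 < measure lebesgue K"
proof -
  have "\<not> negligible K"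
    using open_not_negligible[of "interior K"] center negligible_subset[OF _ interior_subset] by auto
  moreover have "K \<in> lmeasurable" using compact by (rule lmeasurable_compact)
  ultimately show ?thesis using negligible_iff_measure0 zero_less_measure_iff by blast
qed

text \<open>
  At the centre of the chart the gradient is a positive multiple of the moment of the section,
  which is itself a tangent vector \<open>w\<close>; so the differential vanishes on the tangent space only if
  \<open>w \<bullet> w = 0\<close>.
\<close>
lemma critical_point_iff_section_moment_eq_0:
  "critical_point (depth K p) u \<longleftrightarrow> section_moment 0 = 0"
proof -
  have 0: "0 \<in> chart_ball u" by (simp add: chart_ball_def tangent_space_def)
  have grad: "depth_gradient 0 = (1 / measure lebesgue K) *\<^sub>R section_moment 0"
    by (simp add: depth_gradient_def)
  have deriv: "has_sphere_derivative (depth K p) (\<lambda>h. depth_gradient 0 \<bullet> h) u"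
    unfolding has_sphere_derivative_def by (rule depth_has_derivative[OF 0])
  show ?thesis
  proof
    assume "critical_point (depth K p) u"
    then obtain L where L: "has_sphere_derivative (depth K p) L u" "\<And>w. w \<in> tangent_space u \<Longrightarrow> L w = 0"
      by (auto simp: critical_point_def)
    define w where "w = section_moment 0"
    have w: "w \<in> tangent_space u"
      using section_moment_0_orthogonal by (simp add: w_def tangent_space_def)
    define T where "T = {t. t *\<^sub>R w \<in> chart_ball u}"
    have "T = (\<lambda>t. t *\<^sub>R w) -` ball 0 1"
      using w by (auto simp: T_def chart_ball_def tangent_space_def)
    then have "open T"
      by (simp only:) (intro open_vimage open_ball continuous_intros)
    have "0 \<in> T" using 0 by (simp add: T_def)
    \<comment> \<open>A derivative within the chart is unique only on tangent directions; restricting to the line spanned by \<open>w\<close> turns it into an ordinary derivative.\<close>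
    have along: "((\<lambda>t. (depth K p \<circ> sphere_param u) (t *\<^sub>R w)) has_derivative (\<lambda>t. D (t *\<^sub>R w))) (at 0)"
      if "has_sphere_derivative (depth K p) D u" for D
    proof -
      have "((\<lambda>t. t *\<^sub>R w) has_derivative (\<lambda>t. t *\<^sub>R w)) (at 0 within T)"
        by (rule has_derivative_scaleR_left[OF has_derivative_ident])
      moreover have "(depth K p \<circ> sphere_param u has_derivative D) (at (0 *\<^sub>R w) within (\<lambda>t. t *\<^sub>R w) ` T)"
        using that unfolding has_sphere_derivative_def scaleR_zero_left
        by (rule has_derivative_subset) (auto simp: T_def)
      ultimately have "((\<lambda>t. (depth K p \<circ> sphere_param u) (t *\<^sub>R w)) has_derivative (\<lambda>t. D (t *\<^sub>R w))) (at 0 within T)"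
        by (rule has_derivative_in_compose)
      then show ?thesis unfolding at_within_open[OF \<open>0 \<in> T\<close> \<open>open T\<close>] .
    qed
    have "(\<lambda>t. L (t *\<^sub>R w)) = (\<lambda>t. depth_gradient 0 \<bullet> (t *\<^sub>R w))"
      using along[OF L(1)] along[OF deriv] by (rule has_derivative_unique)
    from fun_cong[OF this, of 1] have "depth_gradient 0 \<bullet> w = 0"
      using L(2)[OF w] by simp
    then show "section_moment 0 = 0"
      using measure_K_pos by (simp add: grad w_def)
  next
    assume "section_moment 0 = 0"
    then have "depth_gradient 0 \<bullet> w = 0" for w
      by (simp add: grad)
    with deriv show "critical_point (depth K p) u"
      unfolding critical_point_def by blast
  qed
qed

text \<open>
  The moment about \<open>p\<close> is the measure of the section times the vector from \<open>p\<close> to its barycenter,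
  and the measure is positive because \<open>p\<close> is an interior point of \<open>K\<close>.
\<close>
lemma section_moment_eq_0_iff_barycenter:
  "section_moment 0 = 0 \<longleftrightarrow>
    (1 / measure N (K \<inter> hyperplane_through u p)) *\<^sub>R (LINT x:K \<inter> hyperplane_through u p|N. x) = p"
proof -
  let ?Y = "K \<inter> hyperplane_through u p"
  have Y [measurable]: "?Y \<in> sets borel"
    unfolding hyperplane_through_def by measurable
  have Y_sub: "?Y \<subseteq> cball p radius" using K_subset_cball by blast
  have fin: "emeasure N ?Y < \<infinity>"
    using emeasure_mono[OF Y_sub, of N] emeasure_cball_finite[of radius]
    by (simp add: sets_N order_le_less_trans)
  obtain r where r: "r > 0" "ball p r \<subseteq> K" using center by (auto simp: mem_interior)
  have "emeasure N (ball p r) \<le> emeasure N ?Y"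
    using AE_hyperplane by (intro emeasure_mono_AE) (auto simp: sets_N hyperplane_through_def Y r(2)[THEN subsetD])
  then have pos: "0 < measure N ?Y"
    using emeasure_ball_pos[OF r(1)] fin
    by (simp add: measure_def enn2real_positive_iff order_less_le_trans)
  have int1: "set_integrable N ?Y (\<lambda>z. p)"
    unfolding set_integrable_def using fin by (simp add: sets_N)
  have int2: "set_integrable N ?Y (\<lambda>z. z - p)"
    unfolding set_integrable_def
  proof (rule integrable_bounded_support[where c = radius and r = radius])
    show "AE z in N. norm (indicator ?Y z *\<^sub>R (z - p)) \<le> radius * indicator (cball p radius) z"
      using Y_sub radius_nonneg
      by (intro AE_I2) (auto simp: indicator_def dist_norm norm_minus_commute[of p])
  qed measurable
  have "(LINT x:?Y|N. x) = (LINT x:?Y|N. (x - p) + p)" by simp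
  also have "\<dots> = section_moment 0 + measure N ?Y *\<^sub>R p"
    using int1 int2 fin
    by (subst set_integral_add) (auto simp: section_moment_0 set_lebesgue_integral_def sets_N)
  finally show ?thesis using pos by (simp add: scaleR_add_right)
qed

end

theorem proposition11:
  fixes K :: "(real ^ 'n) set" and p :: "real ^ 'n"
  assumes "convex_body K"
    and "p \<in> interior K"
  shows "C1_on_sphere (depth K p)
    \<and> (\<forall>v\<in>sphere 0 1. critical_point (depth K p) v \<longleftrightarrow> barycentric K p v)"
proof -
  have body: "sliced_convex_body (affine_lborel (hyperplane_through u p)) u p K" if "u \<in> sphere 0 1" for u
  proof -
    interpret hyperplane_slicing "affine_lborel (hyperplane_through u p)" u p
      using that by (intro hyperplane_slicing_affine_lborel) simp
    show ?thesis using assms by unfold_locales (auto simp: convex_body_def)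
  qed
  have "C1_on (depth K p \<circ> sphere_param u) (chart_ball u)" if "u \<in> sphere 0 1" for u
    using sliced_convex_body.C1_on_depth[OF body[OF that]] .
  moreover have "critical_point (depth K p) v \<longleftrightarrow> barycentric K p v" if "v \<in> sphere 0 1" for v
    using sliced_convex_body.critical_point_iff_section_moment_eq_0[OF body[OF that]]
      sliced_convex_body.section_moment_eq_0_iff_barycenter[OF body[OF that]]
    by (simp add: barycentric_def barycenter_def)
  ultimately show ?thesis by (auto simp: C1_on_sphere_def)
qed

end
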